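(* Let $\gamma$ be a smooth curve on the unit sphere $S^2\subset\mathbb R^3$ parametrized by arc length $u$, with geodesic curvature $k_g(u)$, and let $M$ be the cone $X(u,v)=v\,\gamma(u)$, $v>0$, assumed free of umbilic points (i.e. $k_g\neq0$). Then the Darboux curves on $M$ can be integrated by quadratures: the function $$\mathcal I(u,\alpha)=k_g(u)\cos^3\alpha$$ is a first integral of the differential equation of Darboux curves, where $\alpha$ is the angle of the curve with the curves $v=$ const. Moreover, at a ridge ($k_g'(u)=0$), if $k_g''/k_g<0$ the ridge is zigzag, and if $k_g''/k_g>0$ the ridge is beak to beak.
   Context: The chart $(u,v)$ is principal; the principal curvatures are $k_1=k_g(u)/v$ (along $v=$ const) and $k_2=0$ (along $u=$ const). A Darboux curve is a curve whose osculating sphere (contact of order at least 3) at each point is tangent to the surface. In a principal chart with $I=E\,du^2+G\,dv^2$, for an arc-length parametrized curve with $(u',v')=(\frac{\cos\alpha}{\sqrt E},\frac{\sin\alpha}{\sqrt G})$, its differential equation is $3(k_1-k_2)\sin\alpha\cos\alpha\,\alpha'=\frac1{\sqrt E}\frac{\partial k_1}{\partial u}\cos^3\alpha+\frac1{\sqrt G}\frac{\partial k_2}{\partial v}\sin^3\alpha$. A ridge point relative to $k_1$ is a point where $\partial k_1/\partial u=0$; it is zigzag if $\sigma_1=\frac{\partial^2k_1}{\partial u^2}/(k_1-k_2)<0$ and beak to beak if $\sigma_1>0$. *)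

theory Defs
  imports "HOL-Analysis.Analysis"
begin

type_synonym surface = "real \<Rightarrow> real \<Rightarrow> real^3"

abbreviation vderiv :: "(real \<Rightarrow> 'a::real_normed_vector) \<Rightarrow> real \<Rightarrow> 'a" where
  "vderiv f \<equiv> (\<lambda>t. vector_derivative f (at t))"

text \<open>Used for open \<open>J\<close> only, where the two-sided derivatives are those of \<open>f\<close> on \<open>J\<close>.\<close>
definition smooth_curve_on :: "real set \<Rightarrow> (real \<Rightarrow> 'a::real_normed_vector) \<Rightarrow> bool" where
  "smooth_curve_on J f \<longleftrightarrow> (\<forall>n. \<forall>t\<in>J. (vderiv ^^ n) f differentiable (at t))"

definition pd_u :: "(real \<Rightarrow> real \<Rightarrow> 'a::real_normed_vector) \<Rightarrow> real \<Rightarrow> real \<Rightarrow> 'a" where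
  "pd_u f u v = vector_derivative (\<lambda>t. f t v) (at u)"

definition pd_v :: "(real \<Rightarrow> real \<Rightarrow> 'a::real_normed_vector) \<Rightarrow> real \<Rightarrow> real \<Rightarrow> 'a" where
  "pd_v f u v = vector_derivative (\<lambda>t. f u t) (at v)"

definition ff_E :: "surface \<Rightarrow> real \<Rightarrow> real \<Rightarrow> real" where
  "ff_E X u v = pd_u X u v \<bullet> pd_u X u v"

definition ff_F :: "surface \<Rightarrow> real \<Rightarrow> real \<Rightarrow> real" where
  "ff_F X u v = pd_u X u v \<bullet> pd_v X u v"

definition ff_G :: "surface \<Rightarrow> real \<Rightarrow> real \<Rightarrow> real" where
  "ff_G X u v = pd_v X u v \<bullet> pd_v X u v"

text \<open>The orientation is that of \<open>X\<^sub>v \<times> X\<^sub>u\<close>. On the cone \<open>v \<gamma>(u)\<close> this is the normal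
  \<open>\<gamma> \<times> \<gamma>'\<close>, for which the first principal curvature is \<open>k\<^sub>g / v\<close>; the opposite
  choice would only change the sign of both principal curvatures.\<close>
definition unit_normal :: "surface \<Rightarrow> real \<Rightarrow> real \<Rightarrow> real^3" where
  "unit_normal X u v = sgn (cross3 (pd_v X u v) (pd_u X u v))"

definition sf_e :: "surface \<Rightarrow> real \<Rightarrow> real \<Rightarrow> real" where
  "sf_e X u v = pd_u (pd_u X) u v \<bullet> unit_normal X u v"

definition sf_f :: "surface \<Rightarrow> real \<Rightarrow> real \<Rightarrow> real" where
  "sf_f X u v = pd_v (pd_u X) u v \<bullet> unit_normal X u v"

definition sf_g :: "surface \<Rightarrow> real \<Rightarrow> real \<Rightarrow> real" where
  "sf_g X u v = pd_v (pd_v X) u v \<bullet> unit_normal X u v"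

definition umbilic :: "surface \<Rightarrow> real \<Rightarrow> real \<Rightarrow> bool" where
  "umbilic X u v \<longleftrightarrow> (\<exists>l. sf_e X u v = l * ff_E X u v \<and>
      sf_f X u v = l * ff_F X u v \<and> sf_g X u v = l * ff_G X u v)"

definition principal_chart :: "surface \<Rightarrow> (real \<times> real) set \<Rightarrow> bool" where
  "principal_chart X D \<longleftrightarrow> (\<forall>(u,v)\<in>D. cross3 (pd_u X u v) (pd_v X u v) \<noteq> 0 \<and>
      ff_F X u v = 0 \<and> sf_f X u v = 0)"

text \<open>In a principal chart the coordinate directions are the principal ones, so the principal
  curvatures are the normal curvatures of the coordinate curves \<open>v = const\<close> and \<open>u = const\<close>.\<close>
definition curv1 :: "surface \<Rightarrow> real \<Rightarrow> real \<Rightarrow> real" where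
  "curv1 X u v = sf_e X u v / ff_E X u v"

definition curv2 :: "surface \<Rightarrow> real \<Rightarrow> real \<Rightarrow> real" where
  "curv2 X u v = sf_g X u v / ff_G X u v"

text \<open>Arc-length parametrized curves \<open>X (u s) (v s)\<close> in a chart with \<open>I = E du\<^sup>2 + G dv\<^sup>2\<close>,
  making the angle \<open>\<alpha>\<close> with the coordinate curves \<open>v = const\<close>.\<close>
definition arclength_curve ::
  "surface \<Rightarrow> (real \<times> real) set \<Rightarrow> real set \<Rightarrow> (real \<Rightarrow> real) \<Rightarrow> (real \<Rightarrow> real) \<Rightarrow> (real \<Rightarrow> real) \<Rightarrow> bool"
  where
  "arclength_curve X D S u v \<alpha> \<longleftrightarrow> open S \<and> is_interval S \<and>
    (\<forall>s\<in>S. (u s, v s) \<in> D \<and>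
      (u has_real_derivative cos (\<alpha> s) / sqrt (ff_E X (u s) (v s))) (at s) \<and>
      (v has_real_derivative sin (\<alpha> s) / sqrt (ff_G X (u s) (v s))) (at s))"

definition darboux_ode_solution ::
  "surface \<Rightarrow> (real \<times> real) set \<Rightarrow> real set \<Rightarrow> (real \<Rightarrow> real) \<Rightarrow> (real \<Rightarrow> real) \<Rightarrow> (real \<Rightarrow> real) \<Rightarrow> bool"
  where
  "darboux_ode_solution X D S u v \<alpha> \<longleftrightarrow> arclength_curve X D S u v \<alpha> \<and>
    (\<forall>s\<in>S. \<exists>\<alpha>'. (\<alpha> has_real_derivative \<alpha>') (at s) \<and>
      3 * (curv1 X (u s) (v s) - curv2 X (u s) (v s)) * sin (\<alpha> s) * cos (\<alpha> s) * \<alpha>' =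
        pd_u (curv1 X) (u s) (v s) / sqrt (ff_E X (u s) (v s)) * cos (\<alpha> s) ^ 3 +
        pd_v (curv2 X) (u s) (v s) / sqrt (ff_G X (u s) (v s)) * sin (\<alpha> s) ^ 3)"

text \<open>A first integral is constant along every solution and on no nonempty open part of the
  phase space of triples \<open>(u, v, \<alpha>)\<close>.\<close>
definition darboux_first_integral ::
  "surface \<Rightarrow> (real \<times> real) set \<Rightarrow> (real \<Rightarrow> real \<Rightarrow> real \<Rightarrow> real) \<Rightarrow> bool" where
  "darboux_first_integral X D \<Phi> \<longleftrightarrow>
    (\<forall>S u v \<alpha>. darboux_ode_solution X D S u v \<alpha> \<longrightarrow>
       (\<lambda>s. \<Phi> (u s) (v s) (\<alpha> s)) constant_on S) \<and>
    (\<forall>U. open U \<and> U \<noteq> {} \<and> U \<subseteq> {(u, v, a). (u, v) \<in> D} \<longrightarrow>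
       \<not> (\<lambda>(u, v, a). \<Phi> u v a) constant_on U)"

text \<open>Defining function of the sphere tangent to the surface at \<open>P = X u v\<close> with centre
  \<open>P + N / k\<close> and radius \<open>1 / \<bar>k\<bar>\<close>, where \<open>N\<close> is the unit normal. As \<open>k\<close> ranges over the
  nonzero reals, all spheres tangent at \<open>P\<close> occur; \<open>k = 0\<close> gives the tangent plane, regarded as
  a sphere through infinity.\<close>
definition tangent_sphere :: "surface \<Rightarrow> real \<Rightarrow> real \<Rightarrow> real \<Rightarrow> real^3 \<Rightarrow> real" where
  "tangent_sphere X u v k x =
    k * ((x - X u v) \<bullet> (x - X u v)) - 2 * ((x - X u v) \<bullet> unit_normal X u v)"

text \<open>Contact of order at least 3 of a regular curve \<open>c\<close> at \<open>s\<close> with the level set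
  \<open>\<phi> = 0\<close>, at which \<open>\<phi>\<close> has nonzero gradient.\<close>
definition contact3 :: "(real \<Rightarrow> real^3) \<Rightarrow> real \<Rightarrow> (real^3 \<Rightarrow> real) \<Rightarrow> bool" where
  "contact3 c s \<phi> \<longleftrightarrow> (\<forall>n\<le>3. (vderiv ^^ n) (\<lambda>t. \<phi> (c t)) s = 0)"

definition darboux_curve ::
  "surface \<Rightarrow> (real \<times> real) set \<Rightarrow> real set \<Rightarrow> (real \<Rightarrow> real) \<Rightarrow> (real \<Rightarrow> real) \<Rightarrow> bool" where
  "darboux_curve X D S u v \<longleftrightarrow> open S \<and> is_interval S \<and>
    smooth_curve_on S u \<and> smooth_curve_on S v \<and>
    (\<forall>s\<in>S. (u s, v s) \<in> D \<and> vderiv (\<lambda>t. X (u t) (v t)) s \<noteq> 0 \<and>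
      (\<exists>k. contact3 (\<lambda>t. X (u t) (v t)) s (tangent_sphere X (u s) (v s) k)))"

definition ridge_point :: "surface \<Rightarrow> real \<Rightarrow> real \<Rightarrow> bool" where
  "ridge_point X u v \<longleftrightarrow> pd_u (curv1 X) u v = 0"

definition sigma1 :: "surface \<Rightarrow> real \<Rightarrow> real \<Rightarrow> real" where
  "sigma1 X u v = pd_u (pd_u (curv1 X)) u v / (curv1 X u v - curv2 X u v)"

definition zigzag :: "surface \<Rightarrow> real \<Rightarrow> real \<Rightarrow> bool" where
  "zigzag X u v \<longleftrightarrow> ridge_point X u v \<and> sigma1 X u v < 0"

definition beak_to_beak :: "surface \<Rightarrow> real \<Rightarrow> real \<Rightarrow> bool" where
  "beak_to_beak X u v \<longleftrightarrow> ridge_point X u v \<and> sigma1 X u v > 0"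

definition cone_over :: "(real \<Rightarrow> real^3) \<Rightarrow> surface" where
  "cone_over \<gamma> u v = v *\<^sub>R \<gamma> u"

text \<open>For a curve parametrized by arc length on the unit sphere oriented by the outward normal:
  \<open>\<gamma> \<times> \<gamma>'\<close> is the unit conormal.\<close>
definition geodesic_curvature :: "(real \<Rightarrow> real^3) \<Rightarrow> real \<Rightarrow> real" where
  "geodesic_curvature \<gamma> u = vderiv (vderiv \<gamma>) u \<bullet> cross3 (\<gamma> u) (vderiv \<gamma> u)"

end

theory Submission
  imports Defs
begin

text \<open>
  Let \<open>\<nu> = \<gamma> \<times> \<gamma>'\<close> be the normal of the cone, so that \<open>\<gamma>'' \<bullet> \<nu> = k\<^sub>g\<close> and \<open>\<gamma>''' \<bullet> \<nu> = k\<^sub>g'\<close>.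
  For a unit speed curve \<open>c = v \<gamma>(u)\<close> on the cone, \<open>c' \<bullet> c'' = 0\<close>, and \<open>c'' \<bullet> \<nu>\<close> determines the only
  tangent sphere that can have contact of order 3 with \<open>c\<close>; the contact condition reduces to
  \<open>c''' \<bullet> \<nu> = 0\<close>. Here \<open>c''' \<bullet> \<nu> = u' K\<close> with \<open>K = 3 k\<^sub>g (v' u' + v u'') + k\<^sub>g' v u'\<^sup>2\<close>, while
  \<open>cos \<alpha> = v u'\<close> gives \<open>(k\<^sub>g cos\<^sup>3 \<alpha>)' = v\<^sup>2 u'\<^sup>2 K\<close>, and the two expressions have the same zeros.
  The quadrature follows from \<open>(ln v)' = sin \<alpha> / v = tan \<alpha> u'\<close> once \<open>cos \<alpha>\<close> is expressed by
  the first integral.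
\<close>

section \<open>Iterated derivatives on open sets\<close>

lemma smooth_curve_on_vderiv: "smooth_curve_on J f \<Longrightarrow> smooth_curve_on J (vderiv f)"
  unfolding smooth_curve_on_def by (metis funpow_Suc_right comp_apply)

lemma smooth_curve_on_has_vector_derivative:
  assumes "smooth_curve_on J f" "t \<in> J"
  shows "(f has_vector_derivative vderiv f t) (at t)"
  using assms unfolding smooth_curve_on_def
  by (metis funpow_0 vector_derivative_works)

text \<open>Closed formulas for a derivative are available only on an open set such as
  \<open>J\<close> or \<open>S\<close>. Openness is what allows them to be differentiated
  again.\<close>

lemma vderiv_eq_on_open:
  assumes "open S" "t \<in> S" "\<And>x. x \<in> S \<Longrightarrow> f x = g x" "(g has_vector_derivative d) (at t)"
  shows "vderiv f t = d"
  using assms has_vector_derivative_transform_within_open vector_derivative_at by metis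

lemma vderiv_iterates_on_open:
  assumes S: "open S" "t \<in> S"
    and f: "\<And>t. t \<in> S \<Longrightarrow> (f has_vector_derivative f1 t) (at t)"
    and f1: "\<And>t. t \<in> S \<Longrightarrow> (f1 has_vector_derivative f2 t) (at t)"
    and f2: "\<And>t. t \<in> S \<Longrightarrow> (f2 has_vector_derivative f3 t) (at t)"
  shows "vderiv f t = f1 t" "vderiv (vderiv f) t = f2 t" "vderiv (vderiv (vderiv f)) t = f3 t"
proof -
  have 1: "vderiv f t = f1 t" if "t \<in> S" for t
    using f[OF that] by (rule vector_derivative_at)
  have 2: "vderiv (vderiv f) t = f2 t" if "t \<in> S" for t
    using S(1) that 1 f1[OF that] by (rule vderiv_eq_on_open)
  have 3: "vderiv (vderiv (vderiv f)) t = f3 t" if "t \<in> S" for t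
    using S(1) that 2 f2[OF that] by (rule vderiv_eq_on_open)
  show "vderiv f t = f1 t" "vderiv (vderiv f) t = f2 t" "vderiv (vderiv (vderiv f)) t = f3 t"
    using 1 2 3 S(2) by blast+
qed

lemmas has_vector_derivative_inner =
  bounded_bilinear.has_vector_derivative[OF bounded_bilinear_inner]

lemmas has_vector_derivative_cross3 =
  bounded_bilinear.has_vector_derivative[OF bilinear_cross[unfolded bilinear_conv_bounded_bilinear]]

text \<open>Openness gives the forward direction, connectedness of the interval the converse. Both
  the first integral and the Darboux condition are tested through this equivalence.\<close>

lemma derivative_zero_iff_constant_on:
  fixes f :: "real \<Rightarrow> real"
  assumes "open S" "is_interval S" "\<And>s. s \<in> S \<Longrightarrow> (f has_real_derivative f' s) (at s)"
  shows "f constant_on S \<longleftrightarrow> (\<forall>s\<in>S. f' s = 0)"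
proof
  assume "f constant_on S"
  then obtain c where c: "\<And>s. s \<in> S \<Longrightarrow> f s = c"
    unfolding constant_on_def by blast
  show "\<forall>s\<in>S. f' s = 0"
  proof
    fix s assume s: "s \<in> S"
    have "(f has_real_derivative 0) (at s)"
      by (rule has_field_derivative_transform_within_open[OF DERIV_const[of c] assms(1) s]) (simp add: c)
    with assms(3)[OF s] show "f' s = 0" by (rule DERIV_unique)
  qed
next
  assume 0: "\<forall>s\<in>S. f' s = 0"
  have "continuous_on S f"
    using assms(1,3) DERIV_isCont continuous_at_imp_continuous_on by blast
  with 0 assms show "f constant_on S"
    by (intro DERIV_zero_connected_constant_on[of S "{}"])
      (auto simp: is_interval_connected)
qed

section \<open>Contact of a curve with spheres tangent to a surface\<close>

text \<open>The sphere passes through \<open>c s\<close>, so contact of order 0 is automatic. In the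
  next three derivatives the terms with the factor \<open>c t - c s\<close> vanish at
  \<open>t = s\<close>, which leaves one equation for each order.\<close>

lemma contact3_tangent_sphere_iff:
  assumes S: "open S" "s \<in> S" and P: "X a b = c s"
    and c: "\<And>t. t \<in> S \<Longrightarrow> (c has_vector_derivative c1 t) (at t)"
    and c1: "\<And>t. t \<in> S \<Longrightarrow> (c1 has_vector_derivative c2 t) (at t)"
    and c2: "\<And>t. t \<in> S \<Longrightarrow> (c2 has_vector_derivative c3 t) (at t)"
  defines "n \<equiv> unit_normal X a b"
  shows "contact3 c s (tangent_sphere X a b k) \<longleftrightarrow>
    c1 s \<bullet> n = 0 \<and> c2 s \<bullet> n = k * (c1 s \<bullet> c1 s) \<and> c3 s \<bullet> n = 3 * k * (c1 s \<bullet> c2 s)"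
proof -
  define h where "h t = tangent_sphere X a b k (c t)" for t
  define h1 where "h1 t = 2 * k * (c1 t \<bullet> (c t - c s)) - 2 * (c1 t \<bullet> n)" for t
  define h2 where "h2 t = 2 * k * (c2 t \<bullet> (c t - c s) + c1 t \<bullet> c1 t) - 2 * (c2 t \<bullet> n)" for t
  define h3 where "h3 t = 2 * k * (c3 t \<bullet> (c t - c s) + 3 * (c1 t \<bullet> c2 t)) - 2 * (c3 t \<bullet> n)" for t
  have d: "(h has_vector_derivative h1 t) (at t)" "(h1 has_vector_derivative h2 t) (at t)"
    "(h2 has_vector_derivative h3 t) (at t)" if "t \<in> S" for t
    unfolding h_def h1_def h2_def h3_def tangent_sphere_def P n_def[symmetric]
    by (rule derivative_eq_intros has_vector_derivative_inner c[OF that] c1[OF that] c2[OF that] refl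
        | simp add: inner_commute algebra_simps)+
  have "contact3 c s (tangent_sphere X a b k) \<longleftrightarrow> h s = 0 \<and> h1 s = 0 \<and> h2 s = 0 \<and> h3 s = 0"
    using vderiv_iterates_on_open[OF S d]
    unfolding contact3_def h_def[symmetric, abs_def]
    by (auto simp: numeral_3_eq_3 le_Suc_eq)
  moreover have "h s = 0"
    by (simp add: h_def tangent_sphere_def P)
  ultimately show ?thesis
    by (auto simp: h1_def h2_def h3_def)
qed

section \<open>Unit speed curves on the sphere and their geodesic curvature\<close>

locale spherical_curve =
  fixes \<gamma> :: "real \<Rightarrow> real^3" and J :: "real set"
  assumes open_J: "open J"
    and smooth: "smooth_curve_on J \<gamma>"
    and norm_curve: "u \<in> J \<Longrightarrow> norm (\<gamma> u) = 1"
    and norm_deriv: "u \<in> J \<Longrightarrow> norm (vderiv \<gamma> u) = 1"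
begin

abbreviation "\<gamma>1 \<equiv> vderiv \<gamma>"
abbreviation "\<gamma>2 \<equiv> vderiv \<gamma>1"
abbreviation "\<gamma>3 \<equiv> vderiv \<gamma>2"
abbreviation "\<gamma>4 \<equiv> vderiv \<gamma>3"
abbreviation "\<nu> u \<equiv> cross3 (\<gamma> u) (\<gamma>1 u)"
abbreviation "kg \<equiv> geodesic_curvature \<gamma>"
abbreviation "M \<equiv> cone_over \<gamma>"
abbreviation "D \<equiv> {(u, v). u \<in> J \<and> 0 < v}"

lemma has_vector_derivatives:
  assumes "u \<in> J"
  shows "(\<gamma> has_vector_derivative \<gamma>1 u) (at u)" "(\<gamma>1 has_vector_derivative \<gamma>2 u) (at u)"
    "(\<gamma>2 has_vector_derivative \<gamma>3 u) (at u)" "(\<gamma>3 has_vector_derivative \<gamma>4 u) (at u)"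
  by (intro smooth_curve_on_has_vector_derivative[of J] smooth_curve_on_vderiv smooth assms)+

lemma inner_products:
  assumes u: "u \<in> J"
  shows "\<gamma> u \<bullet> \<gamma> u = 1" "\<gamma>1 u \<bullet> \<gamma>1 u = 1" "\<gamma> u \<bullet> \<gamma>1 u = 0" "\<gamma>1 u \<bullet> \<gamma> u = 0"
proof -
  show "\<gamma> u \<bullet> \<gamma> u = 1" "\<gamma>1 u \<bullet> \<gamma>1 u = 1"
    using norm_curve norm_deriv u by (simp_all add: norm_eq_1)
  have "vderiv (\<lambda>t. \<gamma> t \<bullet> \<gamma> t) u = 0"
    by (rule vderiv_eq_on_open[OF open_J u, where g="\<lambda>_. 1"])
      (use norm_curve in \<open>auto simp: norm_eq_1\<close>)
  moreover have "vderiv (\<lambda>t. \<gamma> t \<bullet> \<gamma> t) u = \<gamma> u \<bullet> \<gamma>1 u + \<gamma>1 u \<bullet> \<gamma> u"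
    by (intro vector_derivative_at has_vector_derivative_inner has_vector_derivatives u)
  ultimately show "\<gamma> u \<bullet> \<gamma>1 u = 0" "\<gamma>1 u \<bullet> \<gamma> u = 0"
    by (simp_all add: inner_commute)
qed

text \<open>By Lagrange's identity, the cross product of two orthogonal unit vectors is a unit
  vector.\<close>

lemma norm_conormal: "u \<in> J \<Longrightarrow> norm (\<nu> u) = 1"
  using norm_cross_dot[of "\<gamma> u" "\<gamma>1 u"] inner_products[of u] norm_curve[of u] norm_deriv[of u]
  by (simp add: power2_eq_1_iff)
     (smt (verit) norm_ge_zero)

text \<open>Differentiating \<nu> contributes only \<gamma> x \<gamma>'', which is orthogonal to
  \<gamma>'', so the product rule leaves the term with \<gamma>'''.\<close>

lemma geodesic_curvature_has_vector_derivative: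
  assumes u: "u \<in> J"
  shows "(kg has_vector_derivative \<gamma>3 u \<bullet> \<nu> u) (at u)"
proof -
  have "((\<lambda>t. \<gamma>2 t \<bullet> \<nu> t) has_vector_derivative
      \<gamma>2 u \<bullet> (cross3 (\<gamma> u) (\<gamma>2 u) + cross3 (\<gamma>1 u) (\<gamma>1 u)) + \<gamma>3 u \<bullet> \<nu> u) (at u)"
    by (intro has_vector_derivative_inner has_vector_derivative_cross3 has_vector_derivatives u)
  then show ?thesis
    unfolding geodesic_curvature_def by (simp add: dot_cross_self)
qed

lemma geodesic_curvature_deriv: "u \<in> J \<Longrightarrow> vderiv kg u = \<gamma>3 u \<bullet> \<nu> u"
  by (intro vector_derivative_at geodesic_curvature_has_vector_derivative)

lemma geodesic_curvature_has_real_derivative: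
  "u \<in> J \<Longrightarrow> (kg has_real_derivative vderiv kg u) (at u)"
  using geodesic_curvature_has_vector_derivative
  by (simp add: geodesic_curvature_deriv has_real_derivative_iff_has_vector_derivative)

text \<open>Only differentiability of \<open>vderiv kg\<close> is at stake. The explicit value
  \<open>?d\<close> serves to exhibit it.\<close>

lemma geodesic_curvature_deriv_has_real_derivative:
  assumes u: "u \<in> J"
  shows "(vderiv kg has_real_derivative vderiv (vderiv kg) u) (at u)"
proof -
  have "((\<lambda>t. \<gamma>3 t \<bullet> \<nu> t) has_vector_derivative
      \<gamma>3 u \<bullet> (cross3 (\<gamma> u) (\<gamma>2 u) + cross3 (\<gamma>1 u) (\<gamma>1 u)) + \<gamma>4 u \<bullet> \<nu> u) (at u)"
    (is "(_ has_vector_derivative ?d) _")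
    by (intro has_vector_derivative_inner has_vector_derivative_cross3 has_vector_derivatives u)
  then have d: "(vderiv kg has_vector_derivative ?d) (at u)"
    by (rule has_vector_derivative_transform_within_open[OF _ open_J u])
      (simp add: geodesic_curvature_deriv)
  then have "vderiv (vderiv kg) u = ?d" by (rule vector_derivative_at)
  with d show ?thesis
    by (simp only: has_real_derivative_iff_has_vector_derivative)
qed

section \<open>Fundamental forms of the cone\<close>

lemma cone_pd_v: "pd_v M = (\<lambda>u v. \<gamma> u)"
  unfolding pd_v_def cone_over_def
  by (intro ext vector_derivative_at) (rule derivative_eq_intros refl | simp)+

lemma cone_pd_u: "u \<in> J \<Longrightarrow> pd_u M u v = v *\<^sub>R \<gamma>1 u"
  unfolding pd_u_def cone_over_def
  by (intro vector_derivative_at)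
    (rule derivative_eq_intros has_vector_derivatives refl | assumption | simp)+

lemma cone_pd_uu: "u \<in> J \<Longrightarrow> pd_u (pd_u M) u v = v *\<^sub>R \<gamma>2 u"
  unfolding pd_u_def[of "pd_u M"]
  by (rule vderiv_eq_on_open[OF open_J _ cone_pd_u])
    (rule derivative_eq_intros has_vector_derivatives refl | assumption | simp)+

lemma cone_pd_uv:
  assumes "u \<in> J"
  shows "pd_v (pd_u M) u v = \<gamma>1 u"
proof -
  \<comment> \<open>For fixed \<open>u\<close> in \<open>J\<close> the formula holds at every real
    \<open>v\<close>, so it can be used as an equation between functions of
    \<open>v\<close>.\<close>
  have "pd_u M u = (\<lambda>v. v *\<^sub>R \<gamma>1 u)"
    using assms by (simp add: cone_pd_u fun_eq_iff)
  then show ?thesis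
    unfolding pd_v_def by (simp only:) (intro vector_derivative_at,
      (rule derivative_eq_intros refl | simp)+)
qed

lemma cone_pd_vv: "pd_v (pd_v M) u v = 0"
  unfolding cone_pd_v by (simp add: pd_v_def)

lemma cone_unit_normal:
  assumes "u \<in> J" "0 < v"
  shows "unit_normal M u v = \<nu> u"
  using assms norm_conormal[of u]
  by (simp add: unit_normal_def cone_pd_u cone_pd_v cross_mult_right sgn_scaleR sgn_div_norm)

lemma cone_fundamental_forms:
  assumes "u \<in> J" "0 < v"
  shows "ff_E M u v = v\<^sup>2" "ff_F M u v = 0" "ff_G M u v = 1"
    "sf_e M u v = v * kg u" "sf_f M u v = 0" "sf_g M u v = 0"
  using assms
  by (simp_all add: ff_E_def ff_F_def ff_G_def sf_e_def sf_f_def sf_g_def cone_pd_u cone_pd_v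
      cone_pd_uu cone_pd_uv cone_pd_vv[unfolded cone_pd_v] cone_unit_normal inner_products
      power2_eq_square geodesic_curvature_def dot_cross_self)

section \<open>Principal curvatures, umbilics and ridges of the cone\<close>

lemma cone_curv1: "u \<in> J \<Longrightarrow> 0 < v \<Longrightarrow> curv1 M u v = kg u / v"
  by (simp add: curv1_def cone_fundamental_forms power2_eq_square)

text \<open>The cone is linear in \<open>v\<close>, so \<open>sf_g\<close> vanishes identically. The
  equation holds even outside the chart, where \<open>ff_G\<close> may be 0, because
  \<open>0 / 0 = 0\<close>.\<close>

lemma cone_curv2: "curv2 M = (\<lambda>u v. 0)"
  by (intro ext) (simp add: curv2_def sf_g_def cone_pd_vv)

lemma cone_curv1_pd_u:
  assumes "u \<in> J" "0 < v"
  shows "pd_u (curv1 M) u v = vderiv kg u / v"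
  unfolding pd_u_def
  by (rule vderiv_eq_on_open[OF open_J assms(1) cone_curv1])
    (use assms geodesic_curvature_has_real_derivative[of u] in
      \<open>auto simp: has_real_derivative_iff_has_vector_derivative[symmetric] intro: DERIV_cdivide\<close>)

lemma cone_curv1_pd_uu:
  assumes "u \<in> J" "0 < v"
  shows "pd_u (pd_u (curv1 M)) u v = vderiv (vderiv kg) u / v"
  unfolding pd_u_def[of "pd_u (curv1 M)"]
  by (rule vderiv_eq_on_open[OF open_J assms(1) cone_curv1_pd_u])
    (use assms geodesic_curvature_deriv_has_real_derivative[of u] in
      \<open>auto simp: has_real_derivative_iff_has_vector_derivative[symmetric] intro: DERIV_cdivide\<close>)

text \<open>Since \<open>sf_g\<close> is 0 and \<open>ff_G\<close> is 1, the factor \<open>l\<close>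
  must be 0, and what remains is \<open>v * kg u = 0\<close>.\<close>

lemma cone_umbilic_iff:
  assumes "u \<in> J" "0 < v"
  shows "umbilic M u v \<longleftrightarrow> kg u = 0"
  using assms by (auto simp: umbilic_def cone_fundamental_forms)

lemma cone_principal_chart: "principal_chart M D"
proof -
  have "cross3 (pd_u M u v) (pd_v M u v) \<noteq> 0" if "u \<in> J" "0 < v" for u v
    using that norm_conormal[of u]
    by (auto simp: cone_pd_u cone_pd_v cross_mult_left cross_skew[of "\<gamma>1 u"])
  then show ?thesis
    by (auto simp: principal_chart_def cone_fundamental_forms)
qed

lemma cone_ridge_point_iff:
  assumes "u \<in> J" "0 < v"
  shows "ridge_point M u v \<longleftrightarrow> vderiv kg u = 0"
  using assms by (simp add: ridge_point_def cone_curv1_pd_u)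

text \<open>Numerator and denominator both carry the factor \<open>1 / v\<close>, which cancels. The
  type of a ridge is therefore the same along a whole ruling.\<close>

lemma cone_sigma1:
  assumes "u \<in> J" "0 < v"
  shows "sigma1 M u v = vderiv (vderiv kg) u / kg u"
  using assms by (simp add: sigma1_def cone_curv1_pd_uu cone_curv1 cone_curv2)

section \<open>The Darboux equation and its first integral\<close>

lemma cone_arclength_curveD:
  assumes "arclength_curve M D S u v \<alpha>" "s \<in> S"
  shows "u s \<in> J" "0 < v s"
    "(u has_real_derivative cos (\<alpha> s) / v s) (at s)" "(v has_real_derivative sin (\<alpha> s)) (at s)"
  using assms by (auto simp: arclength_curve_def cone_fundamental_forms)

text \<open>The Darboux equation multiplied by \<open>v * cos \<alpha>\<close> says that the
  derivative of the integral vanishes. The integral is nontrivial because, for fixed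
  \<open>u\<close> with nonzero \<open>kg u\<close>, it varies with the angle on every
  interval.\<close>

lemma cone_darboux_first_integral:
  assumes not_umbilic: "\<And>u. u \<in> J \<Longrightarrow> kg u \<noteq> 0"
  shows "darboux_first_integral M D (\<lambda>u v \<alpha>. kg u * cos \<alpha> ^ 3)"
  unfolding darboux_first_integral_def
proof (intro conjI allI impI)
  fix S u v \<alpha> assume sol: "darboux_ode_solution M D S u v \<alpha>"
  then have arc: "arclength_curve M D S u v \<alpha>"
    by (simp add: darboux_ode_solution_def)
  have "((\<lambda>s. kg (u s) * cos (\<alpha> s) ^ 3) has_real_derivative 0) (at s)" if s: "s \<in> S" for s
  proof -
    note us = cone_arclength_curveD[OF arc s]
    obtain \<alpha>' where \<alpha>': "(\<alpha> has_real_derivative \<alpha>') (at s)"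
      and ode: "3 * (kg (u s) / v s) * sin (\<alpha> s) * cos (\<alpha> s) * \<alpha>' =
        vderiv kg (u s) / v s / v s * cos (\<alpha> s) ^ 3"
      using sol s us(1,2)
      by (auto simp: darboux_ode_solution_def cone_curv1 cone_curv2 cone_curv1_pd_u
          cone_fundamental_forms pd_v_def)
    have kg': "((\<lambda>s. kg (u s)) has_real_derivative vderiv kg (u s) * (cos (\<alpha> s) / v s)) (at s)"
      by (rule DERIV_chain2[OF geodesic_curvature_has_real_derivative us(3)]) (rule us)
    have "((\<lambda>s. kg (u s) * cos (\<alpha> s) ^ 3) has_real_derivative
        vderiv kg (u s) * (cos (\<alpha> s) / v s) * cos (\<alpha> s) ^ 3
        - 3 * cos (\<alpha> s) ^ 2 * sin (\<alpha> s) * \<alpha>' * kg (u s)) (at s)"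
      by (rule derivative_eq_intros kg' \<alpha>' refl | simp add: algebra_simps)+
    \<comment> \<open>The last factor becomes the right side of \<open>ode\<close> minus its left
      side.\<close>
    also have "vderiv kg (u s) * (cos (\<alpha> s) / v s) * cos (\<alpha> s) ^ 3
        - 3 * cos (\<alpha> s) ^ 2 * sin (\<alpha> s) * \<alpha>' * kg (u s) =
        v s * cos (\<alpha> s) * (vderiv kg (u s) / v s / v s * cos (\<alpha> s) ^ 3
          - 3 * (kg (u s) / v s) * sin (\<alpha> s) * cos (\<alpha> s) * \<alpha>')"
      using us(2) by (simp add: field_simps power2_eq_square)
    also have "\<dots> = 0"
      using ode by simp
    finally show ?thesis .
  qed
  then show "(\<lambda>s. kg (u s) * cos (\<alpha> s) ^ 3) constant_on S"
    using arc by (subst derivative_zero_iff_constant_on[where f'="\<lambda>_. 0"])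
      (auto simp: arclength_curve_def)
next
  fix U :: "(real \<times> real \<times> real) set"
  assume U: "open U \<and> U \<noteq> {} \<and> U \<subseteq> {(u, v, a). (u, v) \<in> D}"
  then obtain u v a where uva: "(u, v, a) \<in> U" by auto
  with U have u: "u \<in> J" by auto
  \<comment> \<open>The slice of \<open>U\<close> in the direction of the angle: it is open, so it
    contains an interval around \<open>a\<close>.\<close>
  define A where "A = (\<lambda>a. (u, v, a)) -` U"
  have "open A"
    unfolding A_def using U by (intro open_vimage) (auto intro!: continuous_intros)
  moreover have "a \<in> A" using uva by (simp add: A_def)
  ultimately obtain e where e: "0 < e" "ball a e \<subseteq> A"
    using open_contains_ball by blast
  show "\<not> (\<lambda>(u, v, a). kg u * cos a ^ 3) constant_on U"
  proof
    assume "(\<lambda>(u, v, a). kg u * cos a ^ 3) constant_on U"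
    then have *: "(\<lambda>a. kg u * cos a ^ 3) constant_on ball a e"
      using e(2) unfolding constant_on_def A_def by fastforce
    have d: "((\<lambda>a. kg u * cos a ^ 3) has_real_derivative - 3 * kg u * cos t ^ 2 * sin t) (at t)" for t
      by (rule derivative_eq_intros refl | simp)+
    have "\<forall>t\<in>ball a e. - 3 * kg u * cos t ^ 2 * sin t = 0"
      using * by (subst (asm) derivative_zero_iff_constant_on[OF _ _ d])
        (auto simp: is_interval_ball_real)
    then have z: "sin t * cos t = 0" if "t \<in> ball a e" for t
      using that not_umbilic[OF u] by auto
    \<comment> \<open>One more differentiation gives equal squares of sine and cosine at
      \<open>a\<close>. As one of the two is 0 there, both are, against the sum of their squares
      being 1.\<close>
    have "(\<lambda>t. sin t * cos t) constant_on ball a e"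
      using z unfolding constant_on_def by blast
    moreover have "((\<lambda>t. sin t * cos t) has_real_derivative cos t ^ 2 - sin t ^ 2) (at t)" for t :: real
      by (rule derivative_eq_intros refl | simp add: power2_eq_square)+
    ultimately have "\<forall>t\<in>ball a e. cos t ^ 2 - sin t ^ 2 = 0"
      by (subst (asm) derivative_zero_iff_constant_on) (auto simp: is_interval_ball_real)
    with e(1) have "cos a ^ 2 = sin a ^ 2" by auto
    moreover have "sin a = 0 \<or> cos a = 0" using z[of a] e(1) by simp
    moreover have "sin a ^ 2 + cos a ^ 2 = 1" by simp
    ultimately show False by auto
  qed
qed

section \<open>Darboux curves described by contact with spheres\<close>

text \<open>The angle enters only through its cosine and sine, which equal \<open>v * u1\<close> and
  \<open>v1\<close>. Smoothness of \<open>u\<close> and \<open>v\<close> therefore suffices, and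
  \<alpha> itself may jump by multiples of a full turn.\<close>

lemma cone_darboux_curve_iff:
  assumes arc: "arclength_curve M D S u v \<alpha>"
    and smooth_u: "smooth_curve_on S u" and smooth_v: "smooth_curve_on S v"
  shows "darboux_curve M D S u v \<longleftrightarrow> (\<lambda>s. kg (u s) * cos (\<alpha> s) ^ 3) constant_on S"
proof -
  note us = cone_arclength_curveD[OF arc]
  have S: "open S" "is_interval S" using arc by (auto simp: arclength_curve_def)
  define u1 where "u1 = vderiv u"
  define u2 where "u2 = vderiv u1"
  define u3 where "u3 = vderiv u2"
  define v1 where "v1 = vderiv v"
  define v2 where "v2 = vderiv v1"
  define v3 where "v3 = vderiv v2"
  have du: "(u has_real_derivative u1 s) (at s)" "(u1 has_real_derivative u2 s) (at s)"
    "(u2 has_real_derivative u3 s) (at s)"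
    and dv: "(v has_real_derivative v1 s) (at s)" "(v1 has_real_derivative v2 s) (at s)"
    "(v2 has_real_derivative v3 s) (at s)" if "s \<in> S" for s
    unfolding u1_def u2_def u3_def v1_def v2_def v3_def has_real_derivative_iff_has_vector_derivative
    by (intro smooth_curve_on_has_vector_derivative[of S] smooth_curve_on_vderiv smooth_u smooth_v that)+
  have cos: "cos (\<alpha> s) = v s * u1 s" and sin: "sin (\<alpha> s) = v1 s" if "s \<in> S" for s
    using DERIV_unique[OF du(1) us(3)] DERIV_unique[OF dv(1) us(4)] us(2)[of s] that by auto
  define c where "c t = M (u t) (v t)" for t
  define c1 where "c1 t = v1 t *\<^sub>R \<gamma> (u t) + (v t * u1 t) *\<^sub>R \<gamma>1 (u t)" for t
  define c2 where "c2 t = v2 t *\<^sub>R \<gamma> (u t) + (2 * v1 t * u1 t + v t * u2 t) *\<^sub>R \<gamma>1 (u t)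
    + (v t * u1 t ^ 2) *\<^sub>R \<gamma>2 (u t)" for t
  define c3 where "c3 t = v3 t *\<^sub>R \<gamma> (u t)
    + (3 * v2 t * u1 t + 3 * v1 t * u2 t + v t * u3 t) *\<^sub>R \<gamma>1 (u t)
    + (3 * v1 t * u1 t ^ 2 + 3 * v t * u1 t * u2 t) *\<^sub>R \<gamma>2 (u t)
    + (v t * u1 t ^ 3) *\<^sub>R \<gamma>3 (u t)" for t
  have chain: "((\<lambda>t. g (u t)) has_vector_derivative u1 t *\<^sub>R g') (at t)"
    if "t \<in> S" "(g has_vector_derivative g') (at (u t))" for g :: "real \<Rightarrow> real^3" and g' t
    using vector_diff_chain_at[OF du(1)[OF that(1), unfolded
        has_real_derivative_iff_has_vector_derivative] that(2)]
    by (simp add: o_def)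
  have dc: "(c has_vector_derivative c1 t) (at t)" "(c1 has_vector_derivative c2 t) (at t)"
    "(c2 has_vector_derivative c3 t) (at t)" if t: "t \<in> S" for t
    unfolding c_def c1_def c2_def c3_def cone_over_def
    by (rule derivative_eq_intros chain has_vector_derivatives us(1) du[OF t] dv[OF t] t refl
        | simp add: algebra_simps power2_eq_square power3_eq_cube flip: scaleR_add_left)+
  define K where "K s = 3 * v1 s * u1 s * kg (u s) + 3 * v s * u2 s * kg (u s)
    + v s * u1 s ^ 2 * vderiv kg (u s)" for s
  have n: "unit_normal M (u s) (v s) = \<nu> (u s)" if "s \<in> S" for s
    using us(1,2) that by (simp add: cone_unit_normal)
  \<comment> \<open>As \<gamma> and \<gamma>' are orthogonal to \<nu>, only the components along
    \<gamma>'' and \<gamma>''' contribute.\<close>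
  have c1n: "c1 s \<bullet> \<nu> (u s) = 0" and c3n: "c3 s \<bullet> \<nu> (u s) = u1 s * K s" if "s \<in> S" for s
    using us(1)[OF that]
    by (simp_all add: c1_def c3_def K_def inner_add_left dot_cross_self geodesic_curvature_deriv
        geodesic_curvature_def algebra_simps power2_eq_square power3_eq_cube)
  have c1c1: "c1 s \<bullet> c1 s = 1" if "s \<in> S" for s
    using us(1)[OF that] cos[OF that] sin[OF that] sin_cos_squared_add[of "\<alpha> s"]
    by (simp add: c1_def inner_add_left inner_add_right inner_products power2_eq_square)
  have c1c2: "c1 s \<bullet> c2 s = 0" if s: "s \<in> S" for s
  proof -
    have "vderiv (\<lambda>t. c1 t \<bullet> c1 t) s = 0"
      by (rule vderiv_eq_on_open[OF S(1) s, where g="\<lambda>_. 1"]) (simp_all add: c1c1)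
    moreover have "vderiv (\<lambda>t. c1 t \<bullet> c1 t) s = c1 s \<bullet> c2 s + c2 s \<bullet> c1 s"
      by (intro vector_derivative_at has_vector_derivative_inner dc s)
    ultimately show ?thesis by (simp add: inner_commute)
  qed
  \<comment> \<open>With unit speed the second order condition forces
    \<open>k = c2 s \<bullet> \<nu> (u s)\<close>, and \<open>c1c2\<close> makes the right side of
    the third order condition 0.\<close>
  have contact: "(\<exists>k. contact3 c s (tangent_sphere M (u s) (v s) k)) \<longleftrightarrow> u1 s * K s = 0"
    if s: "s \<in> S" for s
    using contact3_tangent_sphere_iff[OF S(1) s _ dc, of M "u s" "v s"]
    by (auto simp: n c1n c3n c1c1 c1c2 s c_def)
  have "vderiv c s \<noteq> 0" if "s \<in> S" for s
    using vector_derivative_at[OF dc(1)[OF that]] c1c1[OF that] by auto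
  then have "darboux_curve M D S u v \<longleftrightarrow> (\<forall>s\<in>S. u1 s * K s = 0)"
    using S smooth_u smooth_v us(1,2) contact
    unfolding darboux_curve_def c_def[symmetric, abs_def] by auto
  moreover have "(\<lambda>s. kg (u s) * cos (\<alpha> s) ^ 3) constant_on S \<longleftrightarrow>
      (\<forall>s\<in>S. v s ^ 2 * u1 s ^ 2 * K s = 0)"
  proof (rule derivative_zero_iff_constant_on[OF S])
    fix s assume s: "s \<in> S"
    have kg': "((\<lambda>s. kg (u s)) has_real_derivative vderiv kg (u s) * u1 s) (at s)"
      by (rule DERIV_chain2[OF geodesic_curvature_has_real_derivative du(1)]) (use us s in auto)
    \<comment> \<open>The cosine is replaced by \<open>v * u1\<close>, since \<alpha> need not be
      differentiable.\<close>
    have "((\<lambda>s. kg (u s) * (v s * u1 s) ^ 3) has_real_derivative v s ^ 2 * u1 s ^ 2 * K s) (at s)"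
      unfolding K_def
      by (rule derivative_eq_intros kg' du dv s refl
          | simp add: algebra_simps power2_eq_square power3_eq_cube)+
    then show "((\<lambda>s. kg (u s) * cos (\<alpha> s) ^ 3) has_real_derivative v s ^ 2 * u1 s ^ 2 * K s) (at s)"
      by (rule has_field_derivative_transform_within_open[OF _ S(1) s]) (simp add: cos)
  qed
  \<comment> \<open>Positivity of \<open>v\<close> leaves the same two cases on both sides:
    \<open>u1 s = 0\<close>, where the curve is tangent to the ruling, or
    \<open>K s = 0\<close>.\<close>
  moreover have "u1 s * K s = 0 \<longleftrightarrow> v s ^ 2 * u1 s ^ 2 * K s = 0" if "s \<in> S" for s
    using us(2)[OF that] by auto
  ultimately show ?thesis by simp
qed

section \<open>Integration by quadratures\<close>

text \<open>Along the curve the real cube root of \<open>kg / C\<close> is the secant of \<alpha>,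
  so the integrand at \<open>w = u s\<close> is the absolute value of the tangent, and \<epsilon>
  records its sign. Substituting \<open>w = u s\<close> then yields \<epsilon> times the derivative
  of \<open>ln v\<close>.\<close>

lemma cone_darboux_quadrature_ordered:
  assumes not_umbilic: "\<And>u. u \<in> J \<Longrightarrow> kg u \<noteq> 0"
    and arc: "arclength_curve M D S u v \<alpha>"
    and smooth_u: "smooth_curve_on S u" and smooth_v: "smooth_curve_on S v"
    and \<epsilon>: "\<epsilon> \<in> {-1, 1}"
    and \<alpha>: "\<And>s. s \<in> S \<Longrightarrow> cos (\<alpha> s) \<noteq> 0 \<and> \<epsilon> * tan (\<alpha> s) \<ge> 0"
    and C: "\<And>s. s \<in> S \<Longrightarrow> kg (u s) * cos (\<alpha> s) ^ 3 = C"
    and ab: "a \<in> S" "b \<in> S" "a \<le> b"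
  shows "ln (v b) - ln (v a) = \<epsilon> * (LBINT w=u a..u b. sqrt ((root 3 (kg w / C))\<^sup>2 - 1))"
proof -
  note us = cone_arclength_curveD[OF arc]
  define f where "f w = sqrt ((root 3 (kg w / C))\<^sup>2 - 1)" for w
  have S: "open S" "is_interval S" using arc by (auto simp: arclength_curve_def)
  have in_S: "t \<in> S" if "t \<in> {a..b}" for t
    using mem_is_interval_1_I[OF S(2) ab(1,2)] that by auto
  have C0: "C \<noteq> 0"
    using C[OF ab(1)] \<alpha>[OF ab(1)] not_umbilic us(1)[OF ab(1)] by auto
  have f_u: "f (u s) = \<epsilon> * tan (\<alpha> s)" if s: "s \<in> S" for s
  proof -
    have "kg (u s) / C = (1 / cos (\<alpha> s)) ^ 3"
      using C[OF s] C0 \<alpha>[OF s] by (auto simp: field_simps)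
    then have "root 3 (kg (u s) / C) = 1 / cos (\<alpha> s)"
      using odd_real_root_power_cancel[of 3 "1 / cos (\<alpha> s)"] by simp
    then have "(root 3 (kg (u s) / C))\<^sup>2 - 1 = tan (\<alpha> s) ^ 2"
      using \<alpha>[OF s] tan_sec[of "\<alpha> s"] by (simp add: inverse_eq_divide power_divide)
    then show ?thesis
      using \<epsilon> \<alpha>[OF s] by (auto simp: f_def)
  qed
  have kg_cont: "continuous_on J kg"
    using geodesic_curvature_has_real_derivative open_J DERIV_isCont
      continuous_at_imp_continuous_on by blast
  \<comment> \<open>The real functions \<open>sqrt\<close> and \<open>root 3\<close> are continuous
    on the whole line, so this holds even where the radicand is negative.\<close>
  have f_cont: "continuous_on J f"
    unfolding f_def using C0 by (intro continuous_intros kg_cont) auto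
  have u_cont: "continuous_on {a..b} u" and v_cont: "continuous_on {a..b} v"
    using us(3,4) in_S DERIV_isCont by (blast intro: continuous_at_imp_continuous_on)+
  have vderiv_u: "vderiv u s = cos (\<alpha> s) / v s" and vderiv_v: "vderiv v s = sin (\<alpha> s)"
    if "s \<in> S" for s
    using us(3,4)[OF that]
    by (auto simp: has_real_derivative_iff_has_vector_derivative intro: vector_derivative_at)
  \<comment> \<open>The substitution needs continuous derivatives. They come from smoothness of
    \<open>u\<close> and \<open>v\<close> and carry over to the expressions in \<alpha>, which is
    not assumed continuous.\<close>
  have vderiv_cont: "continuous_on {a..b} (vderiv u)" "continuous_on {a..b} (vderiv v)"
    using smooth_curve_on_has_vector_derivative[OF smooth_curve_on_vderiv[OF smooth_u]]
      smooth_curve_on_has_vector_derivative[OF smooth_curve_on_vderiv[OF smooth_v]] in_S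
      has_vector_derivative_continuous
    by (blast intro: continuous_at_imp_continuous_on)+
  have cos_cont: "continuous_on {a..b} (\<lambda>s. cos (\<alpha> s) / v s)"
    using vderiv_cont(1) by (rule continuous_on_cong[THEN iffD1, rotated -1])
      (auto simp: vderiv_u in_S)
  have sin_cont: "continuous_on {a..b} (\<lambda>s. sin (\<alpha> s))"
    using vderiv_cont(2) by (rule continuous_on_cong[THEN iffD1, rotated -1])
      (auto simp: vderiv_v in_S)
  have "(LBINT w=u a..u b. f w) = (LBINT s=a..b. (cos (\<alpha> s) / v s) *\<^sub>R f (u s))"
    by (rule interval_integral_substitution_finite[symmetric, OF ab(3)])
      (use us in_S cos_cont in \<open>auto intro: has_field_derivative_at_within
        continuous_on_subset[OF f_cont]\<close>)
  also have "\<dots> = (LBINT s=a..b. \<epsilon> * (sin (\<alpha> s) / v s))"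
  proof (rule interval_integral_cong)
    fix s assume "s \<in> einterval (min (ereal a) (ereal b)) (max (ereal a) (ereal b))"
    then have "s \<in> S" using ab(3) in_S by (auto simp: einterval_iff min_def max_def split: if_splits)
    then show "(cos (\<alpha> s) / v s) *\<^sub>R f (u s) = \<epsilon> * (sin (\<alpha> s) / v s)"
      using \<alpha>[of s] by (simp add: f_u tan_def)
  qed
  also have "\<dots> = \<epsilon> * ln (v b) - \<epsilon> * ln (v a)"
  proof (rule interval_integral_FTC_finite)
    have eq: "{min a b..max a b} = {a..b}" using ab(3) by simp
    show "continuous_on {min a b..max a b} (\<lambda>s. \<epsilon> * (sin (\<alpha> s) / v s))"
      unfolding eq using us(2) in_S
      by (intro continuous_intros sin_cont v_cont) (auto simp: less_imp_neq[symmetric])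
    show "((\<lambda>s. \<epsilon> * ln (v s)) has_vector_derivative \<epsilon> * (sin (\<alpha> s) / v s))
        (at s within {min a b..max a b})" if "min a b \<le> s" "s \<le> max a b" for s
    proof -
      have s: "s \<in> S" using that ab(3) in_S by simp
      have "((\<lambda>s. \<epsilon> * ln (v s)) has_real_derivative \<epsilon> * (sin (\<alpha> s) / v s)) (at s)"
        using us(2)[OF s] by (auto intro!: derivative_eq_intros us(4)[OF s])
      then show ?thesis
        by (simp add: has_real_derivative_iff_has_vector_derivative has_vector_derivative_at_within)
    qed
  qed
  \<comment> \<open>Multiplication by \<epsilon> removes the sign, because its square is 1.\<close>
  finally show ?thesis
    using \<epsilon> by (auto simp: f_def)
qed

text \<open>The constant \<open>C\<close> is the value of the first integral at
  \<open>s\<^sub>0\<close>. If \<open>s\<close> precedes \<open>s\<^sub>0\<close>, exchanging the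
  endpoints changes the sign of both sides.\<close>

lemma cone_darboux_quadrature:
  assumes not_umbilic: "\<And>u. u \<in> J \<Longrightarrow> kg u \<noteq> 0"
    and arc: "arclength_curve M D S u v \<alpha>" and darboux: "darboux_curve M D S u v"
    and \<epsilon>: "\<epsilon> \<in> {-1, 1}"
    and \<alpha>: "\<And>s. s \<in> S \<Longrightarrow> cos (\<alpha> s) \<noteq> 0 \<and> \<epsilon> * tan (\<alpha> s) \<ge> 0"
    and s: "s\<^sub>0 \<in> S" "s \<in> S"
  shows "ln (v s) = ln (v s\<^sub>0) + \<epsilon> *
    (LBINT w=u s\<^sub>0..u s. sqrt ((root 3 (kg w / (kg (u s\<^sub>0) * cos (\<alpha> s\<^sub>0) ^ 3)))\<^sup>2 - 1))"
proof -
  have smooth_uv: "smooth_curve_on S u" "smooth_curve_on S v"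
    using darboux by (auto simp: darboux_curve_def)
  have C: "kg (u t) * cos (\<alpha> t) ^ 3 = kg (u s\<^sub>0) * cos (\<alpha> s\<^sub>0) ^ 3" if "t \<in> S" for t
    using cone_darboux_curve_iff[OF arc smooth_uv] darboux that s(1)
    unfolding constant_on_def by metis
  note quad = cone_darboux_quadrature_ordered[OF not_umbilic arc smooth_uv \<epsilon> \<alpha> C]
  show ?thesis
  proof (cases "s\<^sub>0 \<le> s")
    case True
    then show ?thesis using quad[OF _ _ _ s(1,2)] by simp
  next
    case False
    then show ?thesis
      using quad[OF _ _ _ s(2,1)]
      by (subst interval_integral_endpoints_reverse) simp
  qed
qed

end

theorem proposition29:
  fixes \<gamma> :: "real \<Rightarrow> real^3" and J :: "real set"
  defines "D \<equiv> {(u, v). u \<in> J \<and> 0 < v}"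
    and "M \<equiv> cone_over \<gamma>"
    and "k\<^sub>g \<equiv> geodesic_curvature \<gamma>"
  assumes "open J" and "is_interval J"
    and "smooth_curve_on J \<gamma>"
    and "\<forall>u\<in>J. norm (\<gamma> u) = 1"
    and "\<forall>u\<in>J. norm (vderiv \<gamma> u) = 1"
    and "\<forall>(u, v)\<in>D. \<not> umbilic M u v"
  shows "principal_chart M D \<and>
    darboux_first_integral M D (\<lambda>u v \<alpha>. k\<^sub>g u * cos \<alpha> ^ 3) \<and>
    (\<forall>S u v \<alpha>. arclength_curve M D S u v \<alpha> \<and> smooth_curve_on S u \<and> smooth_curve_on S v \<longrightarrow>
          (darboux_curve M D S u v \<longleftrightarrow> (\<lambda>s. k\<^sub>g (u s) * cos (\<alpha> s) ^ 3) constant_on S)) \<and>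
    (\<forall>S u v \<alpha> \<epsilon>. arclength_curve M D S u v \<alpha> \<and> darboux_curve M D S u v \<and> \<epsilon> \<in> {-1, 1} \<and>
          (\<forall>s\<in>S. cos (\<alpha> s) \<noteq> 0 \<and> \<epsilon> * tan (\<alpha> s) \<ge> 0) \<longrightarrow>
          (\<forall>s\<^sub>0\<in>S. \<forall>s\<in>S. ln (v s) = ln (v s\<^sub>0) + \<epsilon> *
            (LBINT w=u s\<^sub>0..u s. sqrt ((root 3 (k\<^sub>g w / (k\<^sub>g (u s\<^sub>0) * cos (\<alpha> s\<^sub>0) ^ 3)))\<^sup>2 - 1)))) \<and>
    (\<forall>(u, v)\<in>D. (ridge_point M u v \<longleftrightarrow> vderiv k\<^sub>g u = 0) \<and>
          (vderiv k\<^sub>g u = 0 \<and> vderiv (vderiv k\<^sub>g) u / k\<^sub>g u < 0 \<longrightarrow> zigzag M u v) \<and>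
          (vderiv k\<^sub>g u = 0 \<and> vderiv (vderiv k\<^sub>g) u / k\<^sub>g u > 0 \<longrightarrow> beak_to_beak M u v))"
proof -
  interpret spherical_curve \<gamma> J
    using assms(4,6-8) by unfold_locales auto
  \<comment> \<open>Whether a point of the cone is umbilic depends on \<open>u\<close> alone, so the
    point with \<open>v = 1\<close> on each ruling suffices.\<close>
  have "kg u \<noteq> 0" if "u \<in> J" for u
    using assms(9) cone_umbilic_iff[OF that zero_less_one] that unfolding D_def M_def by auto
  then show ?thesis
    unfolding D_def M_def k\<^sub>g_def
    by (intro conjI allI impI ballI cone_principal_chart cone_darboux_first_integral
        cone_darboux_curve_iff cone_darboux_quadrature)
      (auto simp: cone_ridge_point_iff cone_sigma1 zigzag_def beak_to_beak_def)
qed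

end
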